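(* Let $S$ be a genuine imaginary sphere of $A$, let $M$ be the vector subspace of $A$ inducing $S$, and let $\Omega$ be an open subset of $M$. Let $f:\Omega\to A$ be a function of class $\mathcal C^1$. If $A$ is not associative, assume that $f$ is $M$-admissible. Then on $\Omega\setminus\mathbb R$ the following formula holds: $$\overline\partial_{\mathcal B}f-\overline\vartheta_{\mathcal B}f=-(2\,\mathrm{Im}(x))^{-1}\,\Gamma_{\mathcal B}f .$$
   Context: $A$ is a finite-dimensional real alternative algebra with unity $1\ne0$ (the associator $(x,y,z)=(xy)z-x(yz)$ is an alternating function), $\mathbb R$ is identified with $\mathbb R\cdot 1$, and $A$ is a *-algebra: it carries a real linear anti-involution $x\mapsto x^c$ with $(xy)^c=y^cx^c$ and $x^c=x$ for $x\in\mathbb R$. Put $t(x)=x+x^c$, $n(x)=xx^c$, $\mathbb S_A=\{J\in A: t(J)=0,\ n(J)=1\}$ (assumed non-empty), $\mathbb C_J=\mathrm{span}(1,J)$, and let $Q_A=\bigcup_{J\in\mathbb S_A}\mathbb C_J$ be the quadratic cone. For $x\in Q_A$, $\mathrm{Re}(x)=\frac{x+x^c}2\in\mathbb R$ and $\mathrm{Im}(x)=\frac{x-x^c}2$. A non-empty subset $S\subseteq A$ is a genuine imaginary sphere if there is a real vector subspace $M$ of $A$ with $\mathbb R\subset M\subset Q_A$ and $S=M\cap\mathbb S_A$; then $M=\bigcup_{J\in S}\mathbb C_J$ is unique and is called the vector subspace inducing $S$. Put $m=\dim(M)-1$. On $M$ the formula $\langle x,y\rangle=\frac12t(xy^c)$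 defines a scalar product with $\|x\|^2=n(x)$. Let $\mathcal B=(v_0,v_1,\dots,v_m)$ be an orthonormal basis of $M$ with $v_0=1$, write $x=\sum_{i=0}^m x_iv_i$ for $x\in M$, and let $\partial_i$ be the partial derivative w.r.t. $x_i$ of $A$-valued functions (taken componentwise). Define $$\overline\partial_{\mathcal B}=\tfrac12\Big(\partial_0+\sum_{i=1}^mv_i\partial_i\Big),\qquad \overline\vartheta_{\mathcal B}=\tfrac12\Big(\partial_0+\frac{\mathrm{Im}(x)}{n(\mathrm{Im}(x))}\sum_{i=1}^mx_i\partial_i\Big)\ \text{(off }\mathbb R),$$ $$\Gamma_{\mathcal B}f=-\tfrac12\sum_{i,j=1}^mv_i(v_jL_{ij}f),\qquad L_{ij}=x_i\partial_j-x_j\partial_i .$$ A $\mathcal C^1$ function $f:\Omega\to A$ is $M$-admissible if $f(x)\in M$ and $\overline\partial_{\mathcal B}f(x)\in M$ for all $x\in\Omega$. *)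

theory Defs
  imports "HOL-Analysis.Analysis"
begin

text \<open>
  Multiplication is not assumed associative, so the library classes of real algebras do not apply.
  The class \<open>euclidean_space\<close> provides finite dimension and the canonical topology; no
  compatibility between its inner product and the multiplication or the involution is assumed.
  The subfield \<open>\<real>\<close> is the set of the elements \<open>r *\<^sub>R 1\<close>.
\<close>

class unital_real_algebra = euclidean_space + times + zero_neq_one +
  assumes alt_distrib_right: "(x + y) * z = x * z + y * z"
    and alt_distrib_left: "x * (y + z) = x * y + x * z"
    and alt_scaleR_left: "(r *\<^sub>R x) * y = r *\<^sub>R (x * y)"
    and alt_scaleR_right: "x * (r *\<^sub>R y) = r *\<^sub>R (x * y)"
    and alt_one_left: "1 * x = x"
    and alt_one_right: "x * 1 = x"
begin

definition associator :: "'a \<Rightarrow> 'a \<Rightarrow> 'a \<Rightarrow> 'a"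
  where "associator x y z = (x * y) * z - x * (y * z)"

end

class alternative_star_algebra = unital_real_algebra +
  fixes star :: "'a \<Rightarrow> 'a"
  assumes associator_left: "associator x x y = 0"
    and associator_right: "associator x y y = 0"
    and associator_outer: "associator x y x = 0"
    and star_add: "star (x + y) = star x + star y"
    and star_scaleR: "star (r *\<^sub>R x) = r *\<^sub>R star x"
    and star_star: "star (star x) = x"
    and star_mult: "star (x * y) = star y * star x"
    and star_real: "star (r *\<^sub>R 1) = r *\<^sub>R 1"

definition real_line :: "'a::alternative_star_algebra set"
  where "real_line = range (\<lambda>r. r *\<^sub>R 1)"

text \<open>The real number identified with an element of \<open>real_line\<close>.\<close>

definition real_val :: "'a::alternative_star_algebra \<Rightarrow> real"
  where "real_val y = (THE r. y = r *\<^sub>R 1)"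

definition alg_inverse :: "'a::alternative_star_algebra \<Rightarrow> 'a"
  where "alg_inverse y = (THE z. y * z = 1 \<and> z * y = 1)"

definition alg_trace :: "'a::alternative_star_algebra \<Rightarrow> 'a"
  where "alg_trace x = x + star x"

definition alg_norm :: "'a::alternative_star_algebra \<Rightarrow> 'a"
  where "alg_norm x = x * star x"

definition imag :: "'a::alternative_star_algebra \<Rightarrow> 'a"
  where "imag x = (1/2) *\<^sub>R (x - star x)"

definition imaginary_units :: "'a::alternative_star_algebra set"
  where "imaginary_units = {J. alg_trace J = 0 \<and> alg_norm J = 1}"

definition quadratic_cone :: "'a::alternative_star_algebra set"
  where "quadratic_cone = (\<Union>J\<in>imaginary_units. span {1, J})"

definition induces :: "'a::alternative_star_algebra set \<Rightarrow> 'a set \<Rightarrow> bool"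
  where "induces M S \<longleftrightarrow>
    subspace M \<and> real_line \<subseteq> M \<and> M \<subseteq> quadratic_cone \<and> S = M \<inter> imaginary_units"

definition genuine_imaginary_sphere :: "'a::alternative_star_algebra set \<Rightarrow> bool"
  where "genuine_imaginary_sphere S \<longleftrightarrow> S \<noteq> {} \<and> (\<exists>M. induces M S)"

text \<open>The scalar product on \<open>M\<close>, with its value in \<open>real_line\<close>.\<close>

definition sprod :: "'a::alternative_star_algebra \<Rightarrow> 'a \<Rightarrow> 'a"
  where "sprod x y = (1/2) *\<^sub>R alg_trace (x * star y)"

definition orthonormal_basis ::
    "'a::alternative_star_algebra set \<Rightarrow> nat \<Rightarrow> (nat \<Rightarrow> 'a) \<Rightarrow> bool"
  where "orthonormal_basis M m v \<longleftrightarrow>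
    inj_on v {..m} \<and> independent (v ` {..m}) \<and> span (v ` {..m}) = M \<and>
    (\<forall>i\<le>m. \<forall>j\<le>m. sprod (v i) (v j) = (if i = j then 1 else 0))"

definition coord :: "nat \<Rightarrow> (nat \<Rightarrow> 'a::real_vector) \<Rightarrow> 'a \<Rightarrow> nat \<Rightarrow> real"
  where "coord m v x i = representation (v ` {..m}) x (v i)"

text \<open>
  For \<open>\<Omega>\<close> relatively open in a subspace \<open>M\<close>, differentiability within \<open>\<Omega>\<close> determines
  \<open>f' x\<close> on \<open>M\<close> only. A continuous derivative along \<open>M\<close> always extends to the whole space
  (compose with a projection onto \<open>M\<close>), so this is the usual notion on \<open>M\<close>.
\<close>

definition C1_on :: "'a::euclidean_space set \<Rightarrow> ('a \<Rightarrow> 'a) \<Rightarrow> bool"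
  where "C1_on \<Omega> f \<longleftrightarrow> (\<exists>f' :: 'a \<Rightarrow> 'a \<Rightarrow>\<^sub>L 'a.
    (\<forall>x\<in>\<Omega>. (f has_derivative blinfun_apply (f' x)) (at x within \<Omega>)) \<and> continuous_on \<Omega> f')"

definition pderivative ::
    "(nat \<Rightarrow> 'a::real_normed_vector) \<Rightarrow> nat \<Rightarrow> ('a \<Rightarrow> 'a) \<Rightarrow> 'a \<Rightarrow> 'a"
  where "pderivative v i f x = vector_derivative (\<lambda>h. f (x + h *\<^sub>R v i)) (at 0)"

definition dbar ::
    "nat \<Rightarrow> (nat \<Rightarrow> 'a::alternative_star_algebra) \<Rightarrow> ('a \<Rightarrow> 'a) \<Rightarrow> 'a \<Rightarrow> 'a"
  where "dbar m v f x =
    (1/2) *\<^sub>R (pderivative v 0 f x + (\<Sum>i=1..m. v i * pderivative v i f x))"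

definition thetabar ::
    "nat \<Rightarrow> (nat \<Rightarrow> 'a::alternative_star_algebra) \<Rightarrow> ('a \<Rightarrow> 'a) \<Rightarrow> 'a \<Rightarrow> 'a"
  where "thetabar m v f x =
    (1/2) *\<^sub>R (pderivative v 0 f x +
      (imag x /\<^sub>R real_val (alg_norm (imag x))) *
        (\<Sum>i=1..m. coord m v x i *\<^sub>R pderivative v i f x))"

definition tangential ::
    "nat \<Rightarrow> (nat \<Rightarrow> 'a::real_normed_vector) \<Rightarrow> nat \<Rightarrow> nat \<Rightarrow> ('a \<Rightarrow> 'a) \<Rightarrow> 'a \<Rightarrow> 'a"
  where "tangential m v i j f x =
    coord m v x i *\<^sub>R pderivative v j f x - coord m v x j *\<^sub>R pderivative v i f x"

definition Gamma_op ::
    "nat \<Rightarrow> (nat \<Rightarrow> 'a::alternative_star_algebra) \<Rightarrow> ('a \<Rightarrow> 'a) \<Rightarrow> 'a \<Rightarrow> 'a"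
  where "Gamma_op m v f x =
    - ((1/2) *\<^sub>R (\<Sum>i=1..m. \<Sum>j=1..m. v i * (v j * tangential m v i j f x)))"

definition admissible ::
    "'a::alternative_star_algebra set \<Rightarrow> nat \<Rightarrow> (nat \<Rightarrow> 'a) \<Rightarrow> 'a set \<Rightarrow> ('a \<Rightarrow> 'a) \<Rightarrow> bool"
  where "admissible M m v \<Omega> f \<longleftrightarrow> (\<forall>x\<in>\<Omega>. f x \<in> M \<and> dbar m v f x \<in> M)"

end

theory Submission
  imports Defs
begin

text \<open>
  The identity is pointwise and purely algebraic: nothing is used about the vectors
  \<open>p\<^sub>i = \<partial>\<^sub>i f(x)\<close>. Put \<open>y = Im(x) = \<Sum>\<^sub>i x\<^sub>i v\<^sub>i\<close>, \<open>D = \<Sum>\<^sub>i v\<^sub>i p\<^sub>i\<close> and \<open>E = \<Sum>\<^sub>i x\<^sub>i p\<^sub>i\<close>. Linearizing left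
  alternativity and using \<open>v\<^sub>i y + y v\<^sub>i = -2 x\<^sub>i\<close> gives \<open>v\<^sub>i (y p\<^sub>i) = -2 x\<^sub>i p\<^sub>i - y (v\<^sub>i p\<^sub>i)\<close>, so
  \<open>\<Gamma> f = -(y D + E)\<close>. Since \<open>y\<^sup>2 = -n(y)\<close>, left alternativity also cancels \<open>y\<^sup>-\<^sup>1 (y D) = D\<close>, and
  both sides equal \<open>(D - n(y)\<^sup>-\<^sup>1 y E) / 2\<close>.
\<close>

lemma linear_alt_mult_right: "linear (\<lambda>x. x * (a :: 'a::unital_real_algebra))"
  by (rule linearI) (simp_all add: alt_distrib_right alt_scaleR_left)

lemma linear_alt_mult_left: "linear (\<lambda>x. (a :: 'a::unital_real_algebra) * x)"
  by (rule linearI) (simp_all add: alt_distrib_left alt_scaleR_right)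

lemmas alt_minus_mult_left = linear_neg [OF linear_alt_mult_right]
lemmas alt_minus_mult_right = linear_neg [OF linear_alt_mult_left]
lemmas alt_diff_mult_right = linear_diff [OF linear_alt_mult_left]
lemmas alt_sum_mult_left = linear_sum [OF linear_alt_mult_right]
lemmas alt_sum_mult_right = linear_sum [OF linear_alt_mult_left]

lemma linear_star: "linear (star :: 'a::alternative_star_algebra \<Rightarrow> 'a)"
  by (rule linearI) (simp_all add: star_add star_scaleR)

lemma star_one: "star (1 :: 'a::alternative_star_algebra) = 1"
  using star_real [of 1] by simp

lemma left_alternative: "x * (x * z) = (x * x) * (z :: 'a::alternative_star_algebra)"
  using associator_left [of x z] by (simp add: associator_def)

text \<open>Polarization: apply left alternativity to \<open>x + y\<close> and cancel the two pure
  terms.\<close>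

lemma left_alternative_linearized:
  fixes x y z :: "'a::alternative_star_algebra"
  shows "x * (y * z) + y * (x * z) = (x * y + y * x) * z"
proof -
  have "(x + y) * ((x + y) * z) = ((x + y) * (x + y)) * z"
    by (rule left_alternative)
  then show ?thesis
    by (simp add: alt_distrib_left alt_distrib_right left_alternative algebra_simps)
qed

lemma real_val_scaleR_one: "real_val (r *\<^sub>R (1 :: 'a::alternative_star_algebra)) = r"
  unfolding real_val_def by (rule the_equality) auto

lemma alg_inverse_negative_square:
  fixes y :: "'a::alternative_star_algebra"
  assumes sq: "y * y = - (n *\<^sub>R 1)" and n: "n \<noteq> 0"
  shows "alg_inverse y = - ((1 / n) *\<^sub>R y)"
  unfolding alg_inverse_def
proof (rule the_equality)
  show "y * - ((1 / n) *\<^sub>R y) = 1 \<and> - ((1 / n) *\<^sub>R y) * y = 1"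
    using n by (simp add: alt_minus_mult_right alt_minus_mult_left alt_scaleR_right
        alt_scaleR_left sq)
next
  fix z assume "y * z = 1 \<and> z * y = 1"
  \<comment> \<open>Without associativity, uniqueness still follows: left alternativity turns
    \<open>y * (y * z)\<close> into \<open>(y * y) * z\<close>, a real multiple of \<open>z\<close>,
    so \<open>z\<close> can be solved for.\<close>
  then have "y = y * (y * z)"
    by (simp add: alt_one_right)
  also have "\<dots> = - (n *\<^sub>R z)"
    by (simp add: left_alternative sq alt_minus_mult_left alt_scaleR_left alt_one_left)
  finally have "(1 / n) *\<^sub>R y = (1 / n) *\<^sub>R - (n *\<^sub>R z)"
    by (rule arg_cong)
  then show "z = - ((1 / n) *\<^sub>R y)"
    using n by simp
qed

context
  fixes M :: "'a::alternative_star_algebra set" and m :: nat and v :: "nat \<Rightarrow> 'a"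
  assumes onb: "orthonormal_basis M m v" and v0: "v 0 = 1"
begin

text \<open>Orthogonality to \<open>v 0 = 1\<close> says exactly that \<open>v i\<close> has trace
  zero.\<close>

lemma star_basis:
  assumes "i \<in> {1..m}"
  shows "star (v i) = - v i"
proof -
  have "sprod (v i) (v 0) = 0"
    using onb assms by (simp add: orthonormal_basis_def)
  then have "v i + star (v i) = 0"
    by (simp add: sprod_def alg_trace_def v0 star_one alt_one_right)
  then show ?thesis
    by (simp add: eq_neg_iff_add_eq_0 add.commute)
qed

text \<open>Orthonormality in Clifford form: twice \<open>sprod (v i) (v j)\<close> is
  \<open>v i * star (v j) + v j * star (v i)\<close>, and \<open>star\<close> changes the sign of
  each basis vector involved.\<close>

lemma basis_anticommute:
  assumes "i \<in> {1..m}" "j \<in> {1..m}"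
  shows "v i * v j + v j * v i = (if i = j then - 2 else 0) *\<^sub>R 1"
proof -
  have "(1/2) *\<^sub>R (v i * star (v j) + v j * star (v i)) = (if i = j then 1 else 0)"
    using onb assms
    by (simp add: orthonormal_basis_def sprod_def alg_trace_def star_mult star_star)
  \<comment> \<open>The factor -2 clears both the 1/2 of \<open>sprod\<close> and the sign coming
    from \<open>star\<close>.\<close>
  then have "(- 2) *\<^sub>R ((1/2) *\<^sub>R - (v i * v j + v j * v i)) =
      (- 2 :: real) *\<^sub>R (if i = j then 1 else 0)"
    using assms by (simp add: star_basis alt_minus_mult_right)
  then show ?thesis
    by (cases "i = j") (simp_all add: add.commute)
qed

lemma coord_expansion:
  assumes "x \<in> M"
  shows "x = (\<Sum>i\<le>m. coord m v x i *\<^sub>R v i)"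
proof -
  have inj: "inj_on v {..m}" and ind: "independent (v ` {..m})"
    and sp: "x \<in> span (v ` {..m})"
    using onb assms by (auto simp: orthonormal_basis_def)
  have "x = (\<Sum>b\<in>v ` {..m}. representation (v ` {..m}) x b *\<^sub>R b)"
    using sum_representation_eq [OF ind sp, of "v ` {..m}"] by simp
  also have "\<dots> = (\<Sum>i\<le>m. coord m v x i *\<^sub>R v i)"
    by (simp add: sum.reindex [OF inj] coord_def)
  finally show ?thesis .
qed

lemma coord_expansion_imag:
  assumes "x \<in> M"
  shows "x = coord m v x 0 *\<^sub>R 1 + (\<Sum>i=1..m. coord m v x i *\<^sub>R v i)"
    and "imag x = (\<Sum>i=1..m. coord m v x i *\<^sub>R v i)"
proof -
  let ?y = "\<Sum>i=1..m. coord m v x i *\<^sub>R v i"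
  have "{..m} = insert 0 {1..m}" by auto
  then show x: "x = coord m v x 0 *\<^sub>R 1 + ?y"
    using coord_expansion [OF assms] by (simp add: v0)
  have "star ?y = - ?y"
    by (simp add: linear_sum [OF linear_star] star_scaleR star_basis sum_negf)
  then have "star x = coord m v x 0 *\<^sub>R 1 - ?y"
    by (subst x) (simp add: star_add star_real)
  then have "x - star x = 2 *\<^sub>R ?y"
    by (subst x) (simp add: scaleR_2)
  then show "imag x = ?y"
    by (simp add: imag_def)
qed

lemma basis_imag_anticommute:
  assumes "x \<in> M" "i \<in> {1..m}"
  shows "v i * imag x + imag x * v i = (- 2 * coord m v x i) *\<^sub>R 1"
proof -
  have "v i * imag x + imag x * v i =
      (\<Sum>j=1..m. coord m v x j *\<^sub>R (v i * v j + v j * v i))"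
    by (simp add: coord_expansion_imag(2) [OF assms(1)] alt_sum_mult_left alt_sum_mult_right
        alt_scaleR_left alt_scaleR_right sum.distrib scaleR_add_right)
  also have "\<dots> = (\<Sum>j=1..m. if i = j then (- 2 * coord m v x j) *\<^sub>R 1 else 0)"
    using assms(2) by (intro sum.cong) (auto simp: basis_anticommute)
  finally show ?thesis
    using assms(2) by simp
qed

text \<open>Expanding one factor in each of two copies of the square gives a sum of anticommutators
  of \<open>v i\<close> with \<open>imag x\<close>, all of them real.\<close>

lemma imag_square:
  assumes "x \<in> M"
  shows "imag x * imag x = - ((\<Sum>i=1..m. (coord m v x i)\<^sup>2) *\<^sub>R 1)"
proof -
  let ?c = "coord m v x" and ?y = "imag x"
  have "2 *\<^sub>R (?y * ?y) = (\<Sum>i=1..m. ?c i *\<^sub>R (v i)) * ?y + ?y * (\<Sum>i=1..m. ?c i *\<^sub>R (v i))"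
    by (simp add: scaleR_2 coord_expansion_imag(2) [OF assms])
  also have "\<dots> = (\<Sum>i=1..m. ?c i *\<^sub>R (v i * ?y + ?y * v i))"
    by (simp add: alt_sum_mult_left alt_sum_mult_right alt_scaleR_left alt_scaleR_right
        sum.distrib scaleR_add_right)
  also have "\<dots> = (\<Sum>i=1..m. (- 2 * (?c i)\<^sup>2) *\<^sub>R 1)"
    by (intro sum.cong) (auto simp: basis_imag_anticommute [OF assms] power2_eq_square)
  also have "\<dots> = 2 *\<^sub>R - ((\<Sum>i=1..m. (?c i)\<^sup>2) *\<^sub>R 1)"
    by (simp add: scaleR_sum_left sum_negf scaleR_sum_right)
  finally show ?thesis
    by (rule scaleR_left_imp_eq [rotated]) simp
qed

lemma Gamma_op_eq:
  assumes "x \<in> M"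
  shows "Gamma_op m v f x =
    - (imag x * (\<Sum>i=1..m. v i * pderivative v i f x) +
       (\<Sum>i=1..m. coord m v x i *\<^sub>R pderivative v i f x))"
proof -
  let ?c = "coord m v x" and ?y = "imag x" and ?p = "\<lambda>i. pderivative v i f x"
  let ?D = "\<Sum>i=1..m. v i * ?p i" and ?E = "\<Sum>i=1..m. ?c i *\<^sub>R ?p i"
  \<comment> \<open>The two terms of \<open>tangential\<close> are summed separately. Here the
    coordinates belong to the outer factor \<open>v i\<close>, so that factor sums to
    \<open>?y\<close>.\<close>
  have first: "(\<Sum>i=1..m. \<Sum>j=1..m. ?c i *\<^sub>R (v i * (v j * ?p j))) = ?y * ?D"
    by (simp add: coord_expansion_imag(2) [OF assms] alt_sum_mult_left alt_scaleR_left
        alt_sum_mult_right scaleR_sum_right) (rule sum.swap)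
  \<comment> \<open>In the other term the inner factor sums to \<open>?y\<close>; it has to be moved
    to the outside, at the cost of a real anticommutator.\<close>
  have "v i * (?y * ?p i) = (- 2 * ?c i) *\<^sub>R ?p i - ?y * (v i * ?p i)" if "i \<in> {1..m}" for i
    using left_alternative_linearized [of "v i" ?y "?p i"]
    by (simp add: basis_imag_anticommute [OF assms that] alt_minus_mult_left
        alt_scaleR_left alt_one_left eq_diff_eq)
  then have "(\<Sum>i=1..m. v i * (?y * ?p i)) =
      (\<Sum>i=1..m. (- 2 * ?c i) *\<^sub>R ?p i - ?y * (v i * ?p i))"
    by (intro sum.cong) auto
  also have "\<dots> = - (2 *\<^sub>R ?E) - ?y * ?D"
    by (simp add: sum_subtractf sum_negf alt_sum_mult_right scaleR_sum_right)
  finally have second: "(\<Sum>i=1..m. \<Sum>j=1..m. ?c j *\<^sub>R (v i * (v j * ?p i))) =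
      - (2 *\<^sub>R ?E) - ?y * ?D"
    by (simp add: coord_expansion_imag(2) [OF assms] alt_sum_mult_left alt_scaleR_left
        alt_sum_mult_right alt_scaleR_right)
  have "(\<Sum>i=1..m. \<Sum>j=1..m. v i * (v j * tangential m v i j f x)) =
      (\<Sum>i=1..m. \<Sum>j=1..m. ?c i *\<^sub>R (v i * (v j * ?p j))) -
      (\<Sum>i=1..m. \<Sum>j=1..m. ?c j *\<^sub>R (v i * (v j * ?p i)))"
    by (simp add: tangential_def alt_diff_mult_right alt_scaleR_right sum_subtractf)
  also have "\<dots> = ?y * ?D - (- (2 *\<^sub>R ?E) - ?y * ?D)"
    by (simp only: first second)
  also have "\<dots> = 2 *\<^sub>R (?y * ?D + ?E)"
    by (simp add: scaleR_2)
  finally show ?thesis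
    by (simp add: Gamma_op_def)
qed

lemma dbar_minus_thetabar:
  assumes x: "x \<in> M" and nonreal: "x \<notin> real_line"
  shows "dbar m v f x - thetabar m v f x = - (alg_inverse (2 *\<^sub>R imag x) * Gamma_op m v f x)"
proof -
  let ?c = "coord m v x" and ?y = "imag x" and ?p = "\<lambda>i. pderivative v i f x"
  let ?D = "\<Sum>i=1..m. v i * ?p i" and ?E = "\<Sum>i=1..m. ?c i *\<^sub>R ?p i"
  define n where "n = (\<Sum>i=1..m. (?c i)\<^sup>2)"
  have sq: "?y * ?y = - (n *\<^sub>R 1)"
    unfolding n_def by (rule imag_square [OF x])
  have "n \<noteq> 0"
  proof
    assume "n = 0"
    then have "\<forall>i\<in>{1..m}. ?c i = 0"
      by (simp add: n_def sum_nonneg_eq_0_iff)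
    then have "x = ?c 0 *\<^sub>R 1"
      using coord_expansion_imag(1) [OF x] by simp
    then show False
      using nonreal by (auto simp: real_line_def)
  qed
  \<comment> \<open>This identifies \<open>n\<close>, defined by coordinates, with the norm in the
    denominator of \<open>thetabar\<close>.\<close>
  have "star ?y = - ?y"
    by (simp add: imag_def star_scaleR linear_diff [OF linear_star] star_star
        scaleR_diff_right)
  then have norm: "real_val (alg_norm ?y) = n"
    by (simp add: alg_norm_def alt_minus_mult_right sq real_val_scaleR_one)
  have "(2 *\<^sub>R ?y) * (2 *\<^sub>R ?y) = - ((4 * n) *\<^sub>R 1)"
    by (simp add: alt_scaleR_left alt_scaleR_right sq)
  then have inv: "alg_inverse (2 *\<^sub>R ?y) = - ((1 / (2 * n)) *\<^sub>R ?y)"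
    using alg_inverse_negative_square [of "2 *\<^sub>R ?y" "4 * n"] \<open>n \<noteq> 0\<close> by simp
  have "dbar m v f x - thetabar m v f x = (1/2) *\<^sub>R (?D - (1 / n) *\<^sub>R (?y * ?E))"
    by (simp add: dbar_def thetabar_def norm alt_scaleR_left inverse_eq_divide
        scaleR_diff_right scaleR_add_right)
  \<comment> \<open>Pulling out the scalar of the inverse leaves \<open>- (n *\<^sub>R ?D)\<close>,
    which is \<open>(?y * ?y) * ?D\<close>, hence \<open>?y * (?y * ?D)\<close>.\<close>
  also have "\<dots> = - ((1 / (2 * n)) *\<^sub>R (- (n *\<^sub>R ?D) + ?y * ?E))"
    using \<open>n \<noteq> 0\<close> by (simp add: scaleR_diff_right)
  also have "\<dots> = - ((1 / (2 * n)) *\<^sub>R (?y * (?y * ?D + ?E)))"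
    by (simp only: alt_distrib_left left_alternative sq alt_minus_mult_left alt_scaleR_left
        alt_one_left)
  also have "\<dots> = - (alg_inverse (2 *\<^sub>R ?y) * Gamma_op m v f x)"
    by (simp only: inv Gamma_op_eq [OF x] alt_minus_mult_left alt_minus_mult_right
        alt_scaleR_left minus_minus)
  finally show ?thesis .
qed

end

theorem theorem8:
  fixes S M \<Omega> :: "'a::alternative_star_algebra set"
    and m :: nat and v :: "nat \<Rightarrow> 'a" and f :: "'a \<Rightarrow> 'a"
  assumes "(imaginary_units :: 'a set) \<noteq> {}"
    and "genuine_imaginary_sphere S"
    and "induces M S"
    and "m = dim M - 1"
    and "orthonormal_basis M m v"
    and "v 0 = 1"
    and "openin (top_of_set M) \<Omega>"
    and "C1_on \<Omega> f"
    and "\<not> (\<forall>x y z :: 'a. associator x y z = 0) \<Longrightarrow> admissible M m v \<Omega> f"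
  shows "\<forall>x \<in> \<Omega> - real_line.
    dbar m v f x - thetabar m v f x = - (alg_inverse (2 *\<^sub>R imag x) * Gamma_op m v f x)"
  using dbar_minus_thetabar [OF assms(5,6)] openin_imp_subset [OF assms(7)] by blast

end
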